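(* Let $t$ be a group automorphism of $\mathbb{Z}^n$, and let $X = \mathrm{GAlex}(\mathbb{Z}^n, t)$. Then the following hold: (1) The displacement group $\mathrm{Dis}(X)$ is isomorphic to $(1-t^{-1})\mathbb{Z}^n$. (2) Any connected component of $X$ with a displacement metric $d^{\mathrm{Dis}}_U$ ($U$ any finite generating set of $\mathrm{Dis}(X)$) is quasi-isometric to the $k$-dimensional Euclidean space, where $k = \mathrm{rank}(1-t^{-1})$.
   Context: A quandle is a non-empty set $X$ with a binary operation $\triangleleft$ such that (i) $x \triangleleft x = x$ for all $x$; (ii) for every $y \in X$ the map $s_y \colon X \to X$, $s_y(x) = x \triangleleft y$, is a bijection (the point symmetry at $y$); (iii) $(x \triangleleft y)\triangleleft z = (x \triangleleft z)\triangleleft (y \triangleleft z)$ for all $x,y,z$. $\mathrm{Aut}(X)$ is the group of bijective quandle homomorphisms $X\to X$ with product $fg := g \circ f$; it acts on $X$ from the right by $x\cdot f := f(x)$. $\mathrm{Inn}(X)$ is the subgroup of $\mathrm{Aut}(X)$ generated by $\{s_y \mid y \in X\}$, and the displacement group $\mathrm{Dis}(X)$ is the subgroup generated by $\{s_x s_y^{-1} \mid x,y\in X\}$. A connected component of $X$ is an orbit of $\mathrm{Inn}(X)$; the orbits of $\mathrm{Dis}(X)$ on $X$ are the same sets. For a group $G$ and an automorphism $\sigma$ of $G$, the generalized Alexander quandle $\mathrm{GAlex}(G,\sigma)$ is the set $G$ with the operation $x \triangleleft y := \sigma(xy^{-1})y$; for $G=\mathbb{Z}^n$ written additively and $\sigma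 = t$ this is $x\triangleleft y = t(x-y)+y$. Here $1-t^{-1}$ denotes the endomorphism $v \mapsto v - t^{-1}(v)$ of $\mathbb{Z}^n$, and $(1-t^{-1})\mathbb{Z}^n$ its image. For a generating set $U$ of $\mathrm{Dis}(X)$, consider the undirected graph with vertex set $X$ in which $x,y$ are joined by an edge if $y = x\cdot u$ for some $u \in U\cup U^{-1}$. Its connected components are the connected components of $X$; the displacement metric $d^{\mathrm{Dis}}_U$ on a connected component is the path metric of this graph (edges have length one). *)

theory Defs
  imports
    "HOL-Algebra.Product_Groups"
    "HOL-Algebra.Generated_Groups"
    "HOL-Algebra.FiniteProduct"
    "HOL-Algebra.Bij"
    "HOL-Analysis.Abstract_Euclidean_Space"
    "HOL-Analysis.L2_Norm"
begin

section \<open>Quandles\<close>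

record 'a quandle_struct = "'a partial_object" +
  qop :: "'a \<Rightarrow> 'a \<Rightarrow> 'a" (infixl "\<lhd>\<index>" 70)

text \<open>The point symmetry \<open>s\<^sub>y\<close> is extensional, as are all elements of \<^const>\<open>Bij\<close>.\<close>

definition point_symmetry :: "('a, 'm) quandle_struct_scheme \<Rightarrow> 'a \<Rightarrow> 'a \<Rightarrow> 'a" where
  "point_symmetry X y = (\<lambda>x\<in>carrier X. qop X x y)"

locale quandle =
  fixes X (structure)
  assumes nonempty: "carrier X \<noteq> {}"
    and idem: "x \<in> carrier X \<Longrightarrow> qop X x x = x"
    and bij: "y \<in> carrier X \<Longrightarrow> bij_betw (point_symmetry X y) (carrier X) (carrier X)"
    and distrib: "\<lbrakk>x \<in> carrier X; y \<in> carrier X; z \<in> carrier X\<rbrakk> \<Longrightarrow>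
      qop X (qop X x y) z = qop X (qop X x z) (qop X y z)"

text \<open>Automorphisms act from the right, so \<open>f g\<close> means ``first \<open>f\<close>, then \<open>g\<close>''
  (the opposite of the product in \<^const>\<open>BijGroup\<close>).\<close>

definition Aut :: "('a, 'm) quandle_struct_scheme \<Rightarrow> ('a \<Rightarrow> 'a) monoid" where
  "Aut X = \<lparr>carrier = {f \<in> Bij (carrier X). \<forall>x\<in>carrier X. \<forall>y\<in>carrier X.
                           f (qop X x y) = qop X (f x) (f y)},
            monoid.mult = (\<lambda>f g. compose (carrier X) g f),
            one = (\<lambda>x\<in>carrier X. x)\<rparr>"

definition Inn :: "('a, 'm) quandle_struct_scheme \<Rightarrow> ('a \<Rightarrow> 'a) set" where
  "Inn X = generate (Aut X) (point_symmetry X ` carrier X)"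

definition Dis :: "('a, 'm) quandle_struct_scheme \<Rightarrow> ('a \<Rightarrow> 'a) set" where
  "Dis X = generate (Aut X)
     {point_symmetry X x \<otimes>\<^bsub>Aut X\<^esub> inv\<^bsub>Aut X\<^esub> (point_symmetry X y) | x y.
        x \<in> carrier X \<and> y \<in> carrier X}"

definition Dis_group :: "('a, 'm) quandle_struct_scheme \<Rightarrow> ('a \<Rightarrow> 'a) monoid" where
  "Dis_group X = (Aut X)\<lparr>carrier := Dis X\<rparr>"

definition connected_components :: "('a, 'm) quandle_struct_scheme \<Rightarrow> 'a set set" where
  "connected_components X = (\<lambda>x. (\<lambda>f. f x) ` Inn X) ` carrier X"

definition GAlex :: "('a, 'm) monoid_scheme \<Rightarrow> ('a \<Rightarrow> 'a) \<Rightarrow> 'a quandle_struct" where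
  "GAlex G \<sigma> = \<lparr>carrier = carrier G,
                qop = (\<lambda>x y. \<sigma> (x \<otimes>\<^bsub>G\<^esub> inv\<^bsub>G\<^esub> y) \<otimes>\<^bsub>G\<^esub> y)\<rparr>"

section \<open>Displacement metrics\<close>

definition disp_edges :: "('a, 'm) quandle_struct_scheme \<Rightarrow> ('a \<Rightarrow> 'a) set \<Rightarrow> ('a \<times> 'a) set" where
  "disp_edges X U = {(x, u x) | x u. x \<in> carrier X \<and> u \<in> U \<union> (\<lambda>u. inv\<^bsub>Aut X\<^esub> u) ` U}"

text \<open>The path metric of the graph. On points not joined by any walk the value is unspecified;
  lemma \<open>disp_graph_connected\<close> below shows that this does not happen within a connected
  component.\<close>

definition disp_metric :: "('a, 'm) quandle_struct_scheme \<Rightarrow> ('a \<Rightarrow> 'a) set \<Rightarrow> 'a \<Rightarrow> 'a \<Rightarrow> real" where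
  "disp_metric X U x y = real (LEAST k. (x, y) \<in> disp_edges X U ^^ k)"

definition quasi_isometric ::
    "'a set \<Rightarrow> ('a \<Rightarrow> 'a \<Rightarrow> real) \<Rightarrow> 'b set \<Rightarrow> ('b \<Rightarrow> 'b \<Rightarrow> real) \<Rightarrow> bool" where
  "quasi_isometric M d N e \<longleftrightarrow>
     (\<exists>f A B. f \<in> M \<rightarrow> N \<and> A \<ge> 1 \<and> B \<ge> 0 \<and>
        (\<forall>x\<in>M. \<forall>y\<in>M. d x y / A - B \<le> e (f x) (f y) \<and> e (f x) (f y) \<le> A * d x y + B) \<and>
        (\<forall>z\<in>N. \<exists>x\<in>M. e (f x) z \<le> B))"

text \<open>The points of \<^term>\<open>Euclidean_space k\<close> are the sequences vanishing from index \<open>k\<close> on.\<close>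

definition euclidean_metric :: "nat \<Rightarrow> (nat \<Rightarrow> real) \<Rightarrow> (nat \<Rightarrow> real) \<Rightarrow> real" where
  "euclidean_metric k x y = L2_set (\<lambda>i. x i - y i) {..<k}"

section \<open>Free abelian groups of finite rank and their endomorphisms\<close>

definition Z_power :: "nat \<Rightarrow> (nat \<Rightarrow> int) monoid" where
  "Z_power n = product_group {..<n} (\<lambda>_. integer_group)"

definition one_minus_inverse :: "('a, 'm) monoid_scheme \<Rightarrow> ('a \<Rightarrow> 'a) \<Rightarrow> 'a \<Rightarrow> 'a" where
  "one_minus_inverse G t v = v \<otimes>\<^bsub>G\<^esub> inv\<^bsub>G\<^esub> (inv_into (carrier G) t v)"

definition int_independent :: "('a, 'm) monoid_scheme \<Rightarrow> 'a set \<Rightarrow> bool" where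
  "int_independent G B \<longleftrightarrow> finite B \<and> B \<subseteq> carrier G \<and>
     (\<forall>c :: 'a \<Rightarrow> int. finprod G (\<lambda>b. b [^]\<^bsub>G\<^esub> c b) B = \<one>\<^bsub>G\<^esub> \<longrightarrow> (\<forall>b\<in>B. c b = 0))"

text \<open>Only meaningful if the cardinalities are bounded, as they are by \<open>n\<close> in any subgroup
  of \<^term>\<open>Z_power n\<close>.\<close>

definition abelian_rank :: "('a, 'm) monoid_scheme \<Rightarrow> nat" where
  "abelian_rank G = Max (card ` {B. int_independent G B})"

definition hom_rank :: "('a, 'm) monoid_scheme \<Rightarrow> ('a \<Rightarrow> 'a) \<Rightarrow> nat" where
  "hom_rank G f = abelian_rank (G\<lparr>carrier := f ` carrier G\<rparr>)"

section \<open>Well-definedness\<close>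

lemma Aut_simps:
  "f \<in> carrier (Aut X) \<longleftrightarrow> f \<in> Bij (carrier X) \<and>
     (\<forall>x\<in>carrier X. \<forall>y\<in>carrier X. f (qop X x y) = qop X (f x) (f y))"
  "f \<otimes>\<^bsub>Aut X\<^esub> g = compose (carrier X) g f"
  "\<one>\<^bsub>Aut X\<^esub> = (\<lambda>x\<in>carrier X. x)"
  by (simp_all add: Aut_def)

lemma Bij_mem: "f \<in> Bij S \<Longrightarrow> x \<in> S \<Longrightarrow> f x \<in> S"
  by (auto simp: Bij_def bij_betw_def)

context quandle begin

lemma qop_closed: "x \<in> carrier X \<Longrightarrow> y \<in> carrier X \<Longrightarrow> qop X x y \<in> carrier X"
  using bij[of y] by (auto simp: bij_betw_def point_symmetry_def)

lemma group_Aut: "group (Aut X)"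
proof (rule groupI)
  fix f g assume "f \<in> carrier (Aut X)" "g \<in> carrier (Aut X)"
  then show "f \<otimes>\<^bsub>Aut X\<^esub> g \<in> carrier (Aut X)"
    by (auto simp: Aut_simps compose_Bij compose_eq Bij_mem qop_closed)
next
  show "\<one>\<^bsub>Aut X\<^esub> \<in> carrier (Aut X)"
    by (auto simp: Aut_simps id_Bij qop_closed)
next
  fix f g h assume "f \<in> carrier (Aut X)" "g \<in> carrier (Aut X)" "h \<in> carrier (Aut X)"
  then show "f \<otimes>\<^bsub>Aut X\<^esub> g \<otimes>\<^bsub>Aut X\<^esub> h = f \<otimes>\<^bsub>Aut X\<^esub> (g \<otimes>\<^bsub>Aut X\<^esub> h)"
    by (auto simp: Aut_simps compose_def Bij_mem fun_eq_iff)
next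
  fix f assume "f \<in> carrier (Aut X)"
  then show "\<one>\<^bsub>Aut X\<^esub> \<otimes>\<^bsub>Aut X\<^esub> f = f"
    by (auto simp: Aut_simps compose_def fun_eq_iff Bij_def extensional_def)
next
  fix f assume f: "f \<in> carrier (Aut X)"
  then have fb: "f \<in> Bij (carrier X)" and bb: "bij_betw f (carrier X) (carrier X)"
    and fh: "\<And>x y. x \<in> carrier X \<Longrightarrow> y \<in> carrier X \<Longrightarrow> f (qop X x y) = qop X (f x) (f y)"
    by (auto simp: Aut_simps Bij_def)
  define g where "g = (\<lambda>x\<in>carrier X. inv_into (carrier X) f x)"
  have gB: "g \<in> Bij (carrier X)"
    unfolding g_def by (rule restrict_inv_into_Bij[OF fb])
  have fg: "f (g x) = x" if "x \<in> carrier X" for x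
    using that bb by (simp add: g_def bij_betw_inv_into_right)
  have gf: "g (f x) = x" if "x \<in> carrier X" for x
    using that bb fb by (simp add: g_def bij_betw_inv_into_left Bij_mem)
  have "g (qop X x y) = qop X (g x) (g y)" if "x \<in> carrier X" "y \<in> carrier X" for x y
    using that fg gf fh gB by (metis Bij_mem qop_closed)
  then have "g \<in> carrier (Aut X)"
    using gB by (simp add: Aut_simps)
  moreover have "g \<otimes>\<^bsub>Aut X\<^esub> f = \<one>\<^bsub>Aut X\<^esub>"
    by (auto simp: Aut_simps compose_def fg fun_eq_iff)
  ultimately show "\<exists>g\<in>carrier (Aut X). g \<otimes>\<^bsub>Aut X\<^esub> f = \<one>\<^bsub>Aut X\<^esub>" by blast
qed

lemma point_symmetry_Aut: "y \<in> carrier X \<Longrightarrow> point_symmetry X y \<in> carrier (Aut X)"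
proof -
  assume y: "y \<in> carrier X"
  have "point_symmetry X y (qop X a b) = qop X (point_symmetry X y a) (point_symmetry X y b)"
    if "a \<in> carrier X" "b \<in> carrier X" for a b
    using distrib[OF that y] that by (simp add: point_symmetry_def qop_closed)
  then show ?thesis
    using bij[OF y] by (simp add: Aut_simps Bij_def) (simp add: point_symmetry_def)
qed

lemma Aut_mem: "f \<in> carrier (Aut X) \<Longrightarrow> x \<in> carrier X \<Longrightarrow> f x \<in> carrier X"
  by (simp add: Aut_simps Bij_mem)

lemma Aut_mult_apply: "x \<in> carrier X \<Longrightarrow> (f \<otimes>\<^bsub>Aut X\<^esub> g) x = g (f x)"
  by (simp add: Aut_simps compose_def)

lemma Aut_inv_apply:
  assumes "f \<in> carrier (Aut X)" "x \<in> carrier X"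
  shows "(inv\<^bsub>Aut X\<^esub> f) (f x) = x" "f ((inv\<^bsub>Aut X\<^esub> f) x) = x"
proof -
  have "(f \<otimes>\<^bsub>Aut X\<^esub> inv\<^bsub>Aut X\<^esub> f) x = x" "(inv\<^bsub>Aut X\<^esub> f \<otimes>\<^bsub>Aut X\<^esub> f) x = x"
    unfolding group.r_inv[OF group_Aut assms(1)] group.l_inv[OF group_Aut assms(1)]
    by (simp_all add: Aut_simps(3) assms(2))
  then show "(inv\<^bsub>Aut X\<^esub> f) (f x) = x" "f ((inv\<^bsub>Aut X\<^esub> f) x) = x"
    unfolding Aut_mult_apply[OF assms(2)] .
qed

lemma Dis_gens_subset:
  "{point_symmetry X x \<otimes>\<^bsub>Aut X\<^esub> inv\<^bsub>Aut X\<^esub> (point_symmetry X y) | x y.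
        x \<in> carrier X \<and> y \<in> carrier X} \<subseteq> carrier (Aut X)"
proof -
  interpret A: group "Aut X" by (rule group_Aut)
  show ?thesis using point_symmetry_Aut by blast
qed

lemma Inn_subset: "Inn X \<subseteq> carrier (Aut X)"
  unfolding Inn_def by (rule group.generate_incl[OF group_Aut]) (auto simp: point_symmetry_Aut)

lemma Dis_subset: "Dis X \<subseteq> carrier (Aut X)"
  unfolding Dis_def by (rule group.generate_incl[OF group_Aut Dis_gens_subset])

lemma Dis_group_group: "group (Dis_group X)"
  unfolding Dis_group_def Dis_def
  by (rule subgroup.subgroup_is_group
      [OF group.generate_is_subgroup[OF group_Aut Dis_gens_subset] group_Aut])

lemma Inn_step_Dis:
  assumes "f \<in> Inn X" "x \<in> carrier X"
  shows "\<exists>g\<in>Dis X. g x = f x"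
  using assms(1)[unfolded Inn_def] assms(2)
proof (induction arbitrary: x rule: generate.induct)
  case one
  then show ?case unfolding Dis_def by (blast intro: generate.one)
next
  case (incl h)
  then obtain y where y: "y \<in> carrier X" "h = point_symmetry X y" by blast
  define w where "w = qop X x y"
  have w: "w \<in> carrier X" using incl y by (simp add: w_def qop_closed)
  have "point_symmetry X w w = w" using w idem by (simp add: point_symmetry_def)
  then have "(inv\<^bsub>Aut X\<^esub> (point_symmetry X w)) w = w"
    using Aut_inv_apply(1)[OF point_symmetry_Aut[OF w] w] by simp
  then have "(point_symmetry X y \<otimes>\<^bsub>Aut X\<^esub> inv\<^bsub>Aut X\<^esub> (point_symmetry X w)) x = h x"
    using incl(2) y by (simp add: Aut_mult_apply) (simp add: point_symmetry_def w_def)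
  moreover have "point_symmetry X y \<otimes>\<^bsub>Aut X\<^esub> inv\<^bsub>Aut X\<^esub> (point_symmetry X w) \<in> Dis X"
    unfolding Dis_def using y w by (blast intro: generate.incl)
  ultimately show ?case by blast
next
  case (inv h)
  then obtain y where y: "y \<in> carrier X" "h = point_symmetry X y" by blast
  have "point_symmetry X x x = x" using inv(2) idem by (simp add: point_symmetry_def)
  then have "(point_symmetry X x \<otimes>\<^bsub>Aut X\<^esub> inv\<^bsub>Aut X\<^esub> (point_symmetry X y)) x = (inv\<^bsub>Aut X\<^esub> h) x"
    using inv(2) y by (simp add: Aut_mult_apply)
  moreover have "point_symmetry X x \<otimes>\<^bsub>Aut X\<^esub> inv\<^bsub>Aut X\<^esub> (point_symmetry X y) \<in> Dis X"
    unfolding Dis_def using y inv(2) by (blast intro: generate.incl)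
  ultimately show ?case by blast
next
  case (eng h1 h2)
  obtain g1 where g1: "g1 \<in> Dis X" "g1 x = h1 x" using eng.IH(1) eng.prems by blast
  have "h1 x \<in> carrier X"
    using Aut_mem[OF subsetD[OF Dis_subset g1(1)] eng.prems] g1 by simp
  then obtain g2 where g2: "g2 \<in> Dis X" "g2 (h1 x) = h2 (h1 x)" using eng.IH(2) by blast
  have "g1 \<otimes>\<^bsub>Aut X\<^esub> g2 \<in> Dis X" using g1 g2 unfolding Dis_def by (blast intro: generate.eng)
  then show ?case using g1 g2 eng.prems by (metis Aut_mult_apply)
qed

lemma disp_edges_sym:
  assumes "U \<subseteq> carrier (Aut X)"
  shows "sym (disp_edges X U)"
proof (rule symI)
  fix x y assume "(x, y) \<in> disp_edges X U"
  then obtain u where u: "x \<in> carrier X" "u \<in> U \<union> (\<lambda>u. inv\<^bsub>Aut X\<^esub> u) ` U" "y = u x"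
    by (auto simp: disp_edges_def)
  have uA: "u \<in> carrier (Aut X)"
    using u(2) assms group.inv_closed[OF group_Aut] by auto
  have "inv\<^bsub>Aut X\<^esub> u \<in> U \<union> (\<lambda>u. inv\<^bsub>Aut X\<^esub> u) ` U"
    using u(2) assms group.inv_inv[OF group_Aut] by auto
  moreover have "x = (inv\<^bsub>Aut X\<^esub> u) y" "y \<in> carrier X"
    using u uA Aut_inv_apply Aut_mem by auto
  ultimately show "(y, x) \<in> disp_edges X U"
    unfolding disp_edges_def by blast
qed

lemma generate_walk:
  assumes U: "U \<subseteq> carrier (Aut X)" and "g \<in> generate (Aut X) U" "x \<in> carrier X"
  shows "(x, g x) \<in> (disp_edges X U)\<^sup>*"
  using assms(2,3)
proof (induction arbitrary: x rule: generate.induct)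
  case one
  then show ?case by (simp add: Aut_simps)
next
  case (incl h)
  then show ?case by (intro r_into_rtrancl) (auto simp: disp_edges_def)
next
  case (inv h)
  then show ?case by (intro r_into_rtrancl) (auto simp: disp_edges_def)
next
  case (eng h1 h2)
  have "h1 x \<in> carrier X"
    using Aut_mem subsetD[OF group.generate_incl[OF group_Aut U] eng.hyps(1)] eng.prems by simp
  then show ?case
    using eng by (metis Aut_mult_apply rtrancl_trans)
qed

lemma disp_graph_connected:
  assumes "U \<subseteq> Dis X" "generate (Aut X) U = Dis X"
    and C: "C \<in> connected_components X" "x \<in> C" "y \<in> C"
  shows "\<exists>k. (x, y) \<in> disp_edges X U ^^ k"
proof -
  have U: "U \<subseteq> carrier (Aut X)" using assms(1) Dis_subset by blast
  obtain z where z: "z \<in> carrier X" "C = (\<lambda>f. f z) ` Inn X"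
    using C(1) by (auto simp: connected_components_def)
  have *: "(z, w) \<in> (disp_edges X U)\<^sup>*" if "w \<in> C" for w
  proof -
    obtain f where "f \<in> Inn X" "w = f z" using \<open>w \<in> C\<close> z by blast
    then obtain g where "g \<in> Dis X" "w = g z" using Inn_step_Dis z(1) by metis
    then show ?thesis using generate_walk[OF U _ z(1)] assms(2) by blast
  qed
  have "(x, z) \<in> (disp_edges X U)\<^sup>*"
    using *[OF C(2)] sym_rtrancl[OF disp_edges_sym[OF U]] by (auto dest: symD)
  with *[OF C(3)] have "(x, y) \<in> (disp_edges X U)\<^sup>*" by (rule rtrancl_trans[rotated])
  then show ?thesis by (rule rtrancl_imp_relpow)
qed

end

lemma quandle_GAlex:
  fixes G (structure)
  assumes G: "group G" and s: "\<sigma> \<in> iso G G"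
  shows "quandle (GAlex G \<sigma>)"
proof -
  interpret group G by (rule G)
  have hom: "\<sigma> \<in> hom G G" and bs: "bij_betw \<sigma> (carrier G) (carrier G)"
    using s by (auto simp: iso_def)
  interpret group_hom G G \<sigma> by unfold_locales (rule hom)
  show ?thesis
  proof
    show "carrier (GAlex G \<sigma>) \<noteq> {}" by (auto simp: GAlex_def)
    show "qop (GAlex G \<sigma>) x x = x" if "x \<in> carrier (GAlex G \<sigma>)" for x
      using that by (simp add: GAlex_def)
    show "bij_betw (point_symmetry (GAlex G \<sigma>) y) (carrier (GAlex G \<sigma>)) (carrier (GAlex G \<sigma>))"
      if "y \<in> carrier (GAlex G \<sigma>)" for y
    proof -
      have y: "y \<in> carrier G" using that by (simp add: GAlex_def)
      have b: "bij_betw (\<lambda>x. x \<otimes> z) (carrier G) (carrier G)" if "z \<in> carrier G" for z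
        by (rule bij_betw_byWitness[where f' = "\<lambda>x. x \<otimes> inv z"])
          (use that in \<open>auto simp: m_assoc\<close>)
      have "bij_betw ((\<lambda>x. x \<otimes> y) \<circ> (\<sigma> \<circ> (\<lambda>x. x \<otimes> inv y))) (carrier G) (carrier G)"
        using b[OF y] b[OF group.inv_closed[OF G y]] bs by (blast intro: bij_betw_trans)
      then show ?thesis
        unfolding GAlex_def point_symmetry_def
        by (simp add: bij_betw_def inj_on_def image_def)
    qed
    show "qop (GAlex G \<sigma>) (qop (GAlex G \<sigma>) x y) z =
          qop (GAlex G \<sigma>) (qop (GAlex G \<sigma>) x z) (qop (GAlex G \<sigma>) y z)"
      if "x \<in> carrier (GAlex G \<sigma>)" "y \<in> carrier (GAlex G \<sigma>)" "z \<in> carrier (GAlex G \<sigma>)" for x y z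
    proof -
      have c: "x \<in> carrier G" "y \<in> carrier G" "z \<in> carrier G" using that by (auto simp: GAlex_def)
      have *: "a \<otimes> z \<otimes> inv (b \<otimes> z) = a \<otimes> inv b"
        if "a \<in> carrier G" "b \<in> carrier G" for a b
        using that c by (simp add: inv_mult_group m_assoc flip: m_assoc[of z "inv z" "inv b"])
      have e: "\<sigma> (x \<otimes> inv z) \<otimes> inv (\<sigma> (y \<otimes> inv z)) = \<sigma> (x \<otimes> inv y)"
      proof -
        have "\<sigma> (x \<otimes> inv z) \<otimes> inv (\<sigma> (y \<otimes> inv z)) = \<sigma> (x \<otimes> inv z \<otimes> inv (y \<otimes> inv z))"
          using c by simp
        also have "x \<otimes> inv z \<otimes> inv (y \<otimes> inv z) = x \<otimes> inv y"
          using c by (simp add: inv_mult_group m_assoc flip: m_assoc[of "inv z" z "inv y"])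
        finally show ?thesis .
      qed
      have "\<sigma> (x \<otimes> inv z) \<otimes> z \<otimes> inv (\<sigma> (y \<otimes> inv z) \<otimes> z) = \<sigma> (x \<otimes> inv y)"
        using *[of "\<sigma> (x \<otimes> inv z)" "\<sigma> (y \<otimes> inv z)"] e c by simp
      moreover have "\<sigma> (\<sigma> (x \<otimes> inv y) \<otimes> y \<otimes> inv z) \<otimes> z =
            \<sigma> (\<sigma> (x \<otimes> inv y)) \<otimes> (\<sigma> (y \<otimes> inv z) \<otimes> z)"
        using c by (simp add: m_assoc)
      ultimately show ?thesis
        by (simp add: GAlex_def del: hom_mult)
    qed
  qed
qed

end

theory Submission
  imports Defs
begin

text \<open>
  Write \<open>G\<close> for \<open>\<int>\<^sup>n\<close>, additively. The point symmetry at \<open>y\<close> is \<open>v \<mapsto> t v + (1 - t) y\<close>, so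
  \<open>s\<^sub>x s\<^sub>y\<^sup>-\<^sup>1\<close> is the translation by \<open>(1 - t\<^sup>-\<^sup>1)(y - x)\<close>. These translations already form a group,
  so the displacement group is the group of translations by \<open>H = (1 - t\<^sup>-\<^sup>1) G\<close>
  (lemma \<open>Dis_eq\<close>). A connected component is then a coset \<open>z + H\<close>, a generating set \<open>U\<close> of the
  displacement group is a generating set \<open>S\<close> of \<open>H\<close>, and the displacement metric on \<open>z + H\<close>
  is the word metric of \<open>H\<close> with respect to \<open>S\<close> (lemma \<open>disp_metric_eq_word_length\<close>). This
  holds for every abelian group \<open>G\<close> with an automorphism.

  It remains to see that a finitely generated torsion-free abelian group \<open>H\<close> with a word metric
  is quasi-isometric to \<open>\<real>\<^sup>k\<close>, where \<open>k\<close> is the rank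
  (theorem \<open>torsion_free_quasi_isometric_Euclidean\<close>). The argument avoids choosing a basis.
  Take a maximal independent set \<open>B\<close>. Since \<open>H\<close> is finitely generated, a single \<open>m > 0\<close>
  multiplies all of \<open>H\<close> into the span of \<open>B\<close>; this gives every \<open>h\<close> rational coordinates
  \<open>c\<^sub>b(h) / m\<close>, and they define a homomorphism \<open>H \<rightarrow> \<real>\<^sup>k\<close>. It is Lipschitz because it is additive
  and there are finitely many generators, and its image contains \<open>\<int>\<^sup>k\<close>, so it is coarsely onto.
  For the lower bound, rounding the coordinates down splits \<open>h\<close> into an integer combination of
  \<open>B\<close>, whose word length is at most linear in the coordinates, and a remainder with coordinates
  in \<open>[0, 1)\<close>; as \<open>H\<close> is torsion-free, there are only finitely many such remainders.
\<close>

section \<open>Integer combinations in abelian groups\<close>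

text \<open>Gaussian elimination over \<open>\<int>\<close>: each equation is removed by a cross-multiplication that costs
  one unknown. This is what bounds the rank of a finitely generated abelian group.\<close>

lemma underdetermined_integer_system:
  fixes a :: "'a \<Rightarrow> 'b \<Rightarrow> int"
  assumes "finite S" "finite B" "card S < card B"
  shows "\<exists>c. (\<exists>b\<in>B. c b \<noteq> 0) \<and> (\<forall>s\<in>S. (\<Sum>b\<in>B. c b * a b s) = 0)"
  using assms
proof (induction S arbitrary: B a rule: finite_induct)
  case empty
  then obtain b where "b \<in> B" by fastforce
  then show ?case by (intro exI[of _ "\<lambda>_. 1"]) auto
next
  case (insert s S)
  show ?case
  proof (cases "\<forall>b\<in>B. a b s = 0")
    case True
    obtain c where "\<exists>b\<in>B. c b \<noteq> 0" "\<forall>s\<in>S. (\<Sum>b\<in>B. c b * a b s) = 0"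
      using insert.IH[of B a] insert.prems insert.hyps by auto
    then show ?thesis using True by (intro exI[of _ c]) auto
  next
    case False
    then obtain p where p: "p \<in> B" "a p s \<noteq> 0" by blast
    \<comment> \<open>Eliminate the equation \<open>s\<close> with the pivot \<open>a p s\<close>.\<close>
    define a' where "a' b r = a p s * a b r - a b s * a p r" for b r
    have "card S < card (B - {p})" using insert p by simp
    then obtain d where d: "\<exists>b\<in>B - {p}. d b \<noteq> 0"
      "\<forall>r\<in>S. (\<Sum>b\<in>B - {p}. d b * a' b r) = 0"
      using insert.IH[of "B - {p}" a'] insert.prems by auto
    define c where "c b = (if b = p then - (\<Sum>b\<in>B - {p}. d b * a b s) else a p s * d b)" for b
    have sum_c: "(\<Sum>b\<in>B. c b * a b r) = (\<Sum>b\<in>B - {p}. d b * a' b r)" for r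
    proof -
      have "(\<Sum>b\<in>B. c b * a b r) =
          - (\<Sum>b\<in>B - {p}. d b * a b s) * a p r + (\<Sum>b\<in>B - {p}. a p s * d b * a b r)"
        using p insert.prems by (simp add: sum.remove c_def)
      also have "\<dots> = (\<Sum>b\<in>B - {p}. d b * a' b r)"
        by (simp add: a'_def algebra_simps sum_subtractf sum_distrib_left)
      finally show ?thesis .
    qed
    have "(\<Sum>b\<in>B. c b * a b r) = 0" if "r \<in> insert s S" for r
      using that d(2) by (auto simp: sum_c) (simp add: a'_def)
    moreover have "\<exists>b\<in>B. c b \<noteq> 0" using d(1) p(2) by (auto simp: c_def)
    ultimately show ?thesis by blast
  qed
qed

definition lincomb :: "('a, 'm) monoid_scheme \<Rightarrow> 'a set \<Rightarrow> ('a \<Rightarrow> int) \<Rightarrow> 'a" where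
  "lincomb G B c = finprod G (\<lambda>b. b [^]\<^bsub>G\<^esub> c b) B"

context comm_group begin

lemma lincomb_closed: "B \<subseteq> carrier G \<Longrightarrow> lincomb G B c \<in> carrier G"
  unfolding lincomb_def by (intro finprod_closed) auto

lemma lincomb_cong: "B \<subseteq> carrier G \<Longrightarrow> (\<And>b. b \<in> B \<Longrightarrow> c b = d b) \<Longrightarrow> lincomb G B c = lincomb G B d"
  unfolding lincomb_def by (intro finprod_cong') auto

lemma lincomb_add:
  "B \<subseteq> carrier G \<Longrightarrow> lincomb G B (\<lambda>b. c b + d b) = lincomb G B c \<otimes> lincomb G B d"
  unfolding lincomb_def
  by (subst finprod_multf[symmetric]) (auto simp: int_pow_mult intro!: finprod_cong')

lemma lincomb_zero: "B \<subseteq> carrier G \<Longrightarrow> lincomb G B (\<lambda>_. 0) = \<one>"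
  unfolding lincomb_def by simp

lemma lincomb_insert:
  "finite B \<Longrightarrow> a \<notin> B \<Longrightarrow> insert a B \<subseteq> carrier G \<Longrightarrow>
   lincomb G (insert a B) c = a [^] c a \<otimes> lincomb G B c"
  unfolding lincomb_def by (intro finprod_insert) auto

lemma lincomb_minus:
  assumes "B \<subseteq> carrier G"
  shows "lincomb G B (\<lambda>b. - c b) = inv (lincomb G B c)"
proof -
  have "lincomb G B (\<lambda>b. - c b) \<otimes> lincomb G B c = \<one>"
    using assms by (simp add: lincomb_zero flip: lincomb_add)
  then show ?thesis using assms by (simp add: inv_equality lincomb_closed)
qed

lemma lincomb_pow:
  assumes "B \<subseteq> carrier G"
  shows "lincomb G B c [^] (m::int) = lincomb G B (\<lambda>b. m * c b)"
proof (cases "finite B")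
  case True
  then show ?thesis using assms
  proof (induction B rule: finite_induct)
    case empty
    then show ?case by (simp add: lincomb_def)
  next
    case (insert a B)
    then show ?case
      by (simp add: lincomb_insert int_pow_distrib lincomb_closed int_pow_pow mult.commute)
  qed
qed (simp add: lincomb_def)

lemma lincomb_single:
  assumes "B \<subseteq> carrier G" "finite B" "b \<in> B"
  shows "lincomb G B (\<lambda>x. if x = b then z else 0) = b [^] z"
proof -
  have "lincomb G B (\<lambda>x. if x = b then z else 0) =
      lincomb G (insert b (B - {b})) (\<lambda>x. if x = b then z else 0)"
    using assms by (simp add: insert_absorb)
  also have "\<dots> = b [^] z \<otimes> lincomb G (B - {b}) (\<lambda>x. if x = b then z else 0)"
    using assms by (subst lincomb_insert) auto
  also have "lincomb G (B - {b}) (\<lambda>x. if x = b then z else 0) = lincomb G (B - {b}) (\<lambda>_. 0)"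
    using assms by (intro lincomb_cong) auto
  finally show ?thesis using assms by (simp add: lincomb_zero subset_iff)
qed

lemma subgroup_lincombs:
  assumes "B \<subseteq> carrier G"
  shows "subgroup (range (lincomb G B)) G"
proof (rule subgroupI)
  fix x assume "x \<in> range (lincomb G B)"
  then show "inv x \<in> range (lincomb G B)"
    using assms by (auto simp flip: lincomb_minus)
next
  fix x y assume "x \<in> range (lincomb G B)" "y \<in> range (lincomb G B)"
  then show "x \<otimes> y \<in> range (lincomb G B)"
    using assms by (auto simp flip: lincomb_add)
qed (use assms lincomb_closed in auto)

text \<open>In the abelian case generators can be collected, so every word is an integer combination.\<close>

lemma generate_subset_lincombs:
  assumes "B \<subseteq> carrier G" "finite B"
  shows "generate G B \<subseteq> range (lincomb G B)"
proof (rule generate_subgroup_incl[OF _ subgroup_lincombs[OF assms(1)]])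
  show "B \<subseteq> range (lincomb G B)"
  proof
    fix b assume b: "b \<in> B"
    then have "b = lincomb G B (\<lambda>x. if x = b then 1 else 0)"
      using assms lincomb_single[OF assms b, of 1] by auto
    then show "b \<in> range (lincomb G B)" by blast
  qed
qed

lemma lincomb_lincomb:
  assumes "B \<subseteq> carrier G" "finite B" "S \<subseteq> carrier G" "\<And>b. b \<in> B \<Longrightarrow> b = lincomb G S (a b)"
  shows "lincomb G B c = lincomb G S (\<lambda>s. \<Sum>b\<in>B. c b * a b s)"
  using assms(2,1,4)
proof (induction B rule: finite_induct)
  case empty
  then show ?case using assms(3) by (simp add: lincomb_zero) (simp add: lincomb_def)
next
  case (insert x B)
  have "x [^] c x = lincomb G S (\<lambda>s. c x * a x s)"
    using insert.prems lincomb_pow[OF assms(3), of "a x" "c x"] by simp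
  then show ?case
    using insert assms(3) by (simp add: lincomb_insert lincomb_add)
qed

lemma int_independent_iff:
  "int_independent G B \<longleftrightarrow> finite B \<and> B \<subseteq> carrier G \<and>
     (\<forall>c. lincomb G B c = \<one> \<longrightarrow> (\<forall>b\<in>B. c b = 0))"
  by (simp add: int_independent_def lincomb_def)

text \<open>Independent elements are combinations of the generators. If there were more of them than
  generators, the coefficient matrix would have a nontrivial integer relation between its rows.\<close>

lemma card_int_independent_le:
  assumes S: "finite S" "S \<subseteq> carrier G" "generate G S = carrier G"
    and B: "int_independent G B"
  shows "card B \<le> card S"
proof (rule ccontr)
  assume "\<not> card B \<le> card S"
  have "\<forall>b\<in>B. \<exists>a. b = lincomb G S a"
    using generate_subset_lincombs[OF S(2,1)] B S(3) by (auto simp: int_independent_iff)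
  then obtain a where a: "\<And>b. b \<in> B \<Longrightarrow> b = lincomb G S (a b)" by metis
  obtain c where c: "\<exists>b\<in>B. c b \<noteq> 0" "\<forall>s\<in>S. (\<Sum>b\<in>B. c b * a b s) = 0"
    using underdetermined_integer_system[of S B a] S B \<open>\<not> card B \<le> card S\<close>
    by (auto simp: int_independent_iff)
  have "lincomb G B c = lincomb G S (\<lambda>s. \<Sum>b\<in>B. c b * a b s)"
    using B S a by (intro lincomb_lincomb) (auto simp: int_independent_iff)
  also have "\<dots> = lincomb G S (\<lambda>_. 0)"
    using c S by (intro lincomb_cong) auto
  finally show False using B c S by (auto simp: int_independent_iff lincomb_zero)
qed

text \<open>The bound above makes the maximum in \<^const>\<open>abelian_rank\<close> range over a finite set, so it is
  attained.\<close>

lemma obtain_max_int_independent: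
  assumes S: "finite S" "S \<subseteq> carrier G" "generate G S = carrier G"
  obtains B where "int_independent G B" "card B = abelian_rank G"
    "\<And>B'. int_independent G B' \<Longrightarrow> card B' \<le> card B"
proof -
  let ?cards = "card ` {B. int_independent G B}"
  have "?cards \<subseteq> {..card S}" using card_int_independent_le[OF S] by auto
  then have fin: "finite ?cards" by (rule finite_subset) simp
  have "int_independent G {}" by (simp add: int_independent_def)
  then have "?cards \<noteq> {}" by blast
  then have "Max ?cards \<in> ?cards" using fin by (rule Max_in[rotated])
  then obtain B where B: "int_independent G B" "card B = Max ?cards" by auto
  show ?thesis
  proof (rule that)
    show "card B = abelian_rank G" using B by (simp add: abelian_rank_def)
    show "card B' \<le> card B" if "int_independent G B'" for B'
      using that fin B by (auto intro: Max_ge)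
  qed (fact B)
qed

lemma lincomb_inject:
  assumes "int_independent G B" "lincomb G B c = lincomb G B d" "b \<in> B"
  shows "c b = d b"
proof -
  have B: "B \<subseteq> carrier G" using assms by (simp add: int_independent_iff)
  have "lincomb G B (\<lambda>b. c b + - d b) = \<one>"
    using B assms(2) by (subst lincomb_add) (auto simp: lincomb_minus lincomb_closed)
  then have "\<forall>b\<in>B. c b + - d b = 0" using assms(1) unfolding int_independent_iff by blast
  then show ?thesis using assms(3) by auto
qed

text \<open>Adding \<open>h\<close> to \<open>B\<close> creates a relation, in which \<open>h\<close> itself must have a nonzero coefficient
  because \<open>B\<close> is independent.\<close>

lemma pow_in_lincombs_of_max_independent:
  assumes B: "int_independent G B" "\<And>B'. int_independent G B' \<Longrightarrow> card B' \<le> card B"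
    and h: "h \<in> carrier G"
  shows "\<exists>m>0. h [^] (m::int) \<in> range (lincomb G B)"
proof -
  have Bc: "B \<subseteq> carrier G" and fin: "finite B" using B(1) by (auto simp: int_independent_iff)
  note sub = subgroup_lincombs[OF Bc]
  have "\<exists>m\<noteq>0. h [^] (m::int) \<in> range (lincomb G B)"
  proof (cases "h \<in> B")
    case True
    then show ?thesis
      using lincomb_single[OF Bc fin True, of 1] by (metis rangeI zero_neq_one)
  next
    case False
    then have "\<not> int_independent G (insert h B)"
      using B(2)[of "insert h B"] fin by auto
    then obtain c where c: "lincomb G (insert h B) c = \<one>" "\<exists>b\<in>insert h B. c b \<noteq> 0"
      using fin Bc h by (auto simp: int_independent_iff)
    have e: "h [^] c h \<otimes> lincomb G B c = \<one>"
      using c(1) False fin Bc h by (simp add: lincomb_insert)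
    have "c h \<noteq> 0"
    proof
      assume "c h = 0"
      then have "lincomb G B c = \<one>" using e Bc by (simp add: lincomb_closed)
      then show False using c(2) B(1) \<open>c h = 0\<close> by (auto simp: int_independent_iff)
    qed
    moreover have "h [^] c h = inv (lincomb G B c)"
      using e h Bc by (simp add: inv_equality lincomb_closed)
    ultimately show ?thesis by (metis Bc lincomb_minus rangeI)
  qed
  then obtain m :: int where m: "m \<noteq> 0" "h [^] m \<in> range (lincomb G B)" by blast
  then have "h [^] \<bar>m\<bar> \<in> range (lincomb G B)"
    using h subgroup.m_inv_closed[OF sub m(2)] by (auto simp: abs_if int_pow_neg)
  then show ?thesis using m(1) by (metis zero_less_abs_iff)
qed

text \<open>The product of the denominators of the generators works for all generators, hence for the group,
  since \<open>h \<mapsto> h\<^sup>m\<close> is a homomorphism.\<close>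

lemma obtain_common_denominator:
  assumes S: "finite S" "S \<subseteq> carrier G" "generate G S = carrier G"
    and B: "int_independent G B" "\<And>B'. int_independent G B' \<Longrightarrow> card B' \<le> card B"
  obtains m :: int where "m > 0" "\<And>h. h \<in> carrier G \<Longrightarrow> h [^] m \<in> range (lincomb G B)"
proof -
  have Bc: "B \<subseteq> carrier G" using B(1) by (auto simp: int_independent_iff)
  note sub = subgroup_lincombs[OF Bc]
  have "\<forall>s\<in>S. \<exists>m>0. s [^] (m::int) \<in> range (lincomb G B)"
    using pow_in_lincombs_of_max_independent[OF B] S by auto
  then obtain \<mu> :: "'a \<Rightarrow> int" where \<mu>: "\<And>s. s \<in> S \<Longrightarrow> \<mu> s > 0"
      "\<And>s. s \<in> S \<Longrightarrow> s [^] \<mu> s \<in> range (lincomb G B)" by metis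
  define m where "m = prod \<mu> S"
  interpret P: group_hom G G "\<lambda>x. x [^] m"
    by unfold_locales (auto simp: hom_def int_pow_distrib)
  have "s [^] m \<in> range (lincomb G B)" if "s \<in> S" for s
  proof -
    have "s [^] m = (s [^] \<mu> s) [^] prod \<mu> (S - {s})"
      using that S by (simp add: m_def prod.remove int_pow_pow subset_iff)
    then show ?thesis using \<mu>(2)[OF that] subgroup_int_pow_closed[OF sub] by simp
  qed
  then have "generate G ((\<lambda>x. x [^] m) ` S) \<subseteq> range (lincomb G B)"
    by (intro generate_subgroup_incl[OF _ sub]) auto
  then have "(\<lambda>x. x [^] m) ` carrier G \<subseteq> range (lincomb G B)"
    using P.generate_img[OF S(2)] S(3) by simp
  moreover have "m > 0" using \<mu>(1) by (simp add: m_def prod_pos)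
  ultimately show ?thesis by (intro that[of m]) auto
qed

end

section \<open>Word length\<close>

text \<open>Words grow at the right end, as walks do in the \<open>k\<close>-fold relational power.\<close>

inductive word :: "('a, 'm) monoid_scheme \<Rightarrow> 'a set \<Rightarrow> nat \<Rightarrow> 'a \<Rightarrow> bool" for G S where
  empty: "word G S 0 \<one>\<^bsub>G\<^esub>"
| snoc: "word G S k g \<Longrightarrow> s \<in> S \<union> (\<lambda>s. inv\<^bsub>G\<^esub> s) ` S \<Longrightarrow> word G S (Suc k) (g \<otimes>\<^bsub>G\<^esub> s)"

definition word_length :: "('a, 'm) monoid_scheme \<Rightarrow> 'a set \<Rightarrow> 'a \<Rightarrow> nat" where
  "word_length G S g = (LEAST k. word G S k g)"

lemma (in group) word_closed: "word G S k g \<Longrightarrow> S \<subseteq> carrier G \<Longrightarrow> g \<in> carrier G"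
  by (induction rule: word.induct) auto

lemma (in group) word_mult:
  assumes "word G S l h" "word G S k g" "S \<subseteq> carrier G"
  shows "word G S (k + l) (g \<otimes> h)"
  using assms
proof (induction rule: word.induct)
  case empty
  then show ?case by (simp add: word_closed)
next
  case (snoc l h s)
  have "g \<in> carrier G" "h \<in> carrier G" "s \<in> carrier G"
    using snoc word_closed by auto
  then show ?case
    using word.snoc[OF snoc.IH snoc.hyps(2)] snoc.prems by (simp add: m_assoc)
qed

lemma (in comm_group) word_inv:
  assumes "word G S k g" "S \<subseteq> carrier G"
  shows "word G S k (inv g)"
  using assms
proof (induction rule: word.induct)
  case empty
  then show ?case by (simp add: word.empty)
next
  case (snoc k g s)
  have "g \<in> carrier G" "s \<in> carrier G" using snoc word_closed by auto
  moreover have "inv s \<in> S \<union> (\<lambda>s. inv s) ` S" using snoc by auto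
  ultimately show ?case
    using word.snoc[OF snoc.IH] snoc.prems by (simp add: inv_mult)
qed

lemma (in group) generate_imp_word:
  assumes "g \<in> generate G S" "S \<subseteq> carrier G"
  shows "\<exists>k. word G S k g"
  using assms
proof (induction rule: generate.induct)
  case one
  show ?case using word.empty by blast
next
  case (incl h)
  then have "word G S 1 (\<one> \<otimes> h)" using word.snoc[OF word.empty, of h S G] by auto
  moreover have "\<one> \<otimes> h = h" using incl by (intro l_one) auto
  ultimately show ?case by metis
next
  case (inv h)
  then have "word G S 1 (\<one> \<otimes> inv h)" using word.snoc[OF word.empty, of "inv h" S G] by auto
  moreover have "\<one> \<otimes> inv h = inv h" using inv by (intro l_one inv_closed) auto
  ultimately show ?case by metis
next
  case (eng g h)
  then show ?case using word_mult by blast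
qed

locale fg_comm_group = comm_group G for G (structure) +
  fixes S
  assumes finite_S: "finite S" and S_closed: "S \<subseteq> carrier G"
    and generate_S: "generate G S = carrier G"
begin

lemma word_word_length: "g \<in> carrier G \<Longrightarrow> word G S (word_length G S g) g"
  unfolding word_length_def using generate_imp_word[OF _ S_closed] generate_S
  by (metis LeastI_ex)

lemma word_length_le: "word G S k g \<Longrightarrow> word_length G S g \<le> k"
  unfolding word_length_def by (rule Least_le)

lemma word_length_one: "word_length G S \<one> = 0"
  using word_length_le[OF word.empty] by simp

lemma word_length_mult:
  "g \<in> carrier G \<Longrightarrow> h \<in> carrier G \<Longrightarrow>
   word_length G S (g \<otimes> h) \<le> word_length G S g + word_length G S h"
  by (intro word_length_le word_mult word_word_length S_closed)

lemma word_length_inv: "g \<in> carrier G \<Longrightarrow> word_length G S (inv g) \<le> word_length G S g"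
  by (intro word_length_le word_inv word_word_length S_closed)

lemma word_length_nat_pow:
  "g \<in> carrier G \<Longrightarrow> word_length G S (g [^] (k::nat)) \<le> k * word_length G S g"
proof (induction k)
  case (Suc k)
  then show ?case using word_length_mult[of "g [^] k" g] by simp
qed (simp add: word_length_one)

lemma word_length_int_pow:
  assumes g: "g \<in> carrier G"
  shows "word_length G S (g [^] (z::int)) \<le> nat \<bar>z\<bar> * word_length G S g"
proof (cases z rule: int_cases2)
  case (nonneg k)
  then show ?thesis using word_length_nat_pow[OF g, of k] by (simp add: int_pow_int)
next
  case (nonpos k)
  have "word_length G S (g [^] z) \<le> word_length G S (g [^] k)"
    using word_length_inv[of "g [^] k"] g nonpos by (simp add: int_pow_neg_int)
  also have "\<dots> \<le> k * word_length G S g" by (rule word_length_nat_pow[OF g])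
  finally show ?thesis using nonpos by simp
qed

text \<open>Only the size of the coefficients enters linearly; the lengths of the elements of \<open>B\<close> are
  constants.\<close>

lemma word_length_lincomb:
  "finite B \<Longrightarrow> B \<subseteq> carrier G \<Longrightarrow>
   word_length G S (lincomb G B q) \<le> (\<Sum>b\<in>B. nat \<bar>q b\<bar> * word_length G S b)"
proof (induction B rule: finite_induct)
  case empty
  then show ?case by (simp add: lincomb_def word_length_one)
next
  case (insert b B)
  have "word_length G S (b [^] q b \<otimes> lincomb G B q)
      \<le> word_length G S (b [^] q b) + word_length G S (lincomb G B q)"
    using insert by (intro word_length_mult) (auto simp: lincomb_closed)
  moreover have "word_length G S (b [^] q b) \<le> nat \<bar>q b\<bar> * word_length G S b"
    using insert by (intro word_length_int_pow) auto
  ultimately show ?case using insert by (simp add: lincomb_insert)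
qed

end

section \<open>Quasi-isometry with Euclidean space\<close>

lemma quasi_isometric_isometry:
  assumes f: "bij_betw f M M'" "\<And>x y. x \<in> M \<Longrightarrow> y \<in> M \<Longrightarrow> d' (f x) (f y) = d x y"
    and q: "quasi_isometric M d N e"
  shows "quasi_isometric M' d' N e"
proof -
  obtain \<phi> A B where \<phi>: "\<phi> \<in> M \<rightarrow> N" "A \<ge> 1" "B \<ge> 0"
    "\<And>x y. x \<in> M \<Longrightarrow> y \<in> M \<Longrightarrow> d x y / A - B \<le> e (\<phi> x) (\<phi> y) \<and> e (\<phi> x) (\<phi> y) \<le> A * d x y + B"
    "\<And>z. z \<in> N \<Longrightarrow> \<exists>x\<in>M. e (\<phi> x) z \<le> B"
    using q unfolding quasi_isometric_def by blast
  define g where "g = inv_into M f"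
  have g: "g x \<in> M" "f (g x) = x" if "x \<in> M'" for x
    using f(1) that by (auto simp: g_def bij_betw_def inv_into_into f_inv_into_f)
  have gf: "g (f x) = x" "f x \<in> M'" if "x \<in> M" for x
    using f(1) that by (auto simp: g_def bij_betw_def)
  have d: "d (g x) (g y) = d' x y" if "x \<in> M'" "y \<in> M'" for x y
    using f(2)[of "g x" "g y"] g that by simp
  show ?thesis
    unfolding quasi_isometric_def
  proof (intro exI conjI ballI)
    show "(\<phi> \<circ> g) \<in> M' \<rightarrow> N" using \<phi>(1) g by auto
    fix x y assume xy: "x \<in> M'" "y \<in> M'"
    show "d' x y / A - B \<le> e ((\<phi> \<circ> g) x) ((\<phi> \<circ> g) y)" "e ((\<phi> \<circ> g) x) ((\<phi> \<circ> g) y) \<le> A * d' x y + B"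
      using \<phi>(4)[of "g x" "g y"] xy by (auto simp: g d)
  next
    fix z assume "z \<in> N"
    then obtain x where "x \<in> M" "e (\<phi> x) z \<le> B" using \<phi>(5) by blast
    then show "\<exists>x\<in>M'. e ((\<phi> \<circ> g) x) z \<le> B" using gf by (intro bexI[of _ "f x"]) auto
  qed (use \<phi> in auto)
qed

text \<open>The element \<open>h\<close> has the rational coordinates \<open>coord h b / m\<close> for \<open>b \<in> B\<close>. Working with the
  numerators keeps all computations in the group, without tensoring with \<open>\<rat>\<close>.\<close>

locale rational_coordinates = fg_comm_group G S for G (structure) and S +
  fixes B and m :: int
  assumes independent: "int_independent G B"
    and m_pos: "m > 0"
    and pow_m: "h \<in> carrier G \<Longrightarrow> h [^] m \<in> range (lincomb G B)"
    and torsion_free: "h \<in> carrier G \<Longrightarrow> h [^] m = \<one> \<Longrightarrow> h = \<one>"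
begin

lemma finite_B: "finite B" and B_closed: "B \<subseteq> carrier G"
  using independent by (auto simp: int_independent_def)

text \<open>The numerators are determined only on \<open>B\<close>; off \<open>B\<close> the choice is arbitrary.\<close>

definition coord :: "'a \<Rightarrow> 'a \<Rightarrow> int" where
  "coord h = (SOME c. h [^] m = lincomb G B c)"

definition coord_norm :: "'a \<Rightarrow> int" where
  "coord_norm h = (\<Sum>b\<in>B. \<bar>coord h b\<bar>)"

lemma pow_m_eq:
  assumes "h \<in> carrier G"
  shows "h [^] m = lincomb G B (coord h)"
proof -
  obtain c where "h [^] m = lincomb G B c" using pow_m[OF assms] by auto
  then show ?thesis
    unfolding coord_def by (rule someI[where P = "\<lambda>c. h [^] m = lincomb G B c"])
qed

lemma coord_eqI: "h \<in> carrier G \<Longrightarrow> h [^] m = lincomb G B c \<Longrightarrow> b \<in> B \<Longrightarrow> coord h b = c b"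
  using lincomb_inject[OF independent] pow_m_eq by metis

lemma coord_mult:
  assumes "g \<in> carrier G" "h \<in> carrier G" "b \<in> B"
  shows "coord (g \<otimes> h) b = coord g b + coord h b"
  using assms
  by (intro coord_eqI) (auto simp: int_pow_distrib lincomb_add[OF B_closed] simp flip: pow_m_eq)

lemma coord_inv:
  assumes "g \<in> carrier G" "b \<in> B"
  shows "coord (inv g) b = - coord g b"
  using assms
  by (intro coord_eqI) (auto simp: int_pow_inv lincomb_minus[OF B_closed] simp flip: pow_m_eq)

lemma coord_lincomb: "b \<in> B \<Longrightarrow> coord (lincomb G B q) b = m * q b"
  by (intro coord_eqI) (auto simp: lincomb_closed lincomb_pow B_closed)

lemma coord_norm_mult:
  "g \<in> carrier G \<Longrightarrow> h \<in> carrier G \<Longrightarrow> coord_norm (g \<otimes> h) \<le> coord_norm g + coord_norm h"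
  unfolding coord_norm_def by (auto simp: coord_mult simp flip: sum.distrib intro!: sum_mono)

text \<open>The coordinates are additive, so their norm grows by a bounded amount with every letter of a
  word.\<close>

lemma coord_norm_le_word_length:
  assumes "h \<in> carrier G"
  shows "coord_norm h \<le> (\<Sum>s\<in>S. coord_norm s) * word_length G S h"
proof -
  have nn: "coord_norm s \<ge> 0" for s by (simp add: coord_norm_def sum_nonneg)
  have "coord_norm g \<le> (\<Sum>s\<in>S. coord_norm s) * k" if "word G S k g" for k g
    using that
  proof (induction rule: word.induct)
    case empty
    have "coord \<one> b = 0" if "b \<in> B" for b
      using that by (intro coord_eqI) (auto simp: lincomb_zero[OF B_closed])
    then show ?case by (simp add: coord_norm_def)
  next
    case (snoc k g s)
    have g: "g \<in> carrier G" using word_closed snoc S_closed by blast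
    obtain u where u: "u \<in> S" "s = u \<or> s = inv u" using snoc by auto
    then have uc: "u \<in> carrier G" using S_closed by blast
    have "coord_norm s = coord_norm u"
      using u(2) uc by (auto simp: coord_norm_def coord_inv)
    also have "\<dots> \<le> (\<Sum>s\<in>S. coord_norm s)"
      using u finite_S nn by (intro member_le_sum) auto
    finally show ?case
      using coord_norm_mult[OF g, of s] snoc.IH u uc by (auto simp: algebra_simps)
  qed
  then show ?thesis using word_word_length[OF assms] by blast
qed

text \<open>Rounding down: \<open>h = r \<otimes> (\<Otimes>b. b [^] \<lfloor>c\<^sub>b / m\<rfloor>)\<close>, where the numerators of \<open>r\<close> lie in \<open>{0..<m}\<close>.
  Without torsion, \<open>r\<close> is determined by \<open>r [^] m\<close>, so there are finitely many \<open>r\<close>.\<close>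

lemma word_length_le_coord_norm:
  "\<exists>W C. W \<ge> 0 \<and> C \<ge> 0 \<and>
     (\<forall>h\<in>carrier G. real (word_length G S h) \<le> W * (coord_norm h / m) + C)"
proof -
  define R where "R = {r \<in> carrier G. \<exists>c \<in> B \<rightarrow>\<^sub>E {0..<m}. r [^] m = lincomb G B c}"
  have inj: "inj_on (\<lambda>r. r [^] m) (carrier G)"
  proof (rule inj_onI)
    fix x y assume xy: "x \<in> carrier G" "y \<in> carrier G" "x [^] m = y [^] m"
    then have "(x \<otimes> inv y) [^] m = \<one>" by (simp add: int_pow_distrib int_pow_inv)
    then have "x \<otimes> inv y = \<one>" using torsion_free xy by blast
    moreover have "x \<otimes> inv y \<otimes> y = x" using xy by (simp add: m_assoc)
    ultimately show "x = y" using xy by simp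
  qed
  have "(\<lambda>r. r [^] m) ` R \<subseteq> lincomb G B ` (B \<rightarrow>\<^sub>E {0..<m})" by (auto simp: R_def)
  then have "finite ((\<lambda>r. r [^] m) ` R)"
    by (rule finite_subset) (intro finite_imageI finite_PiE finite_B, simp)
  moreover have "inj_on (\<lambda>r. r [^] m) R"
    by (rule inj_on_subset[OF inj]) (auto simp: R_def)
  ultimately have finR: "finite R" by (rule finite_imageD)
  \<comment> \<open>The sums are crude upper bounds for the maxima over \<open>R\<close> and \<open>B\<close>; they need no case
    distinction for empty sets.\<close>
  define C where "C = (\<Sum>r\<in>R. word_length G S r)"
  define W where "W = (\<Sum>b\<in>B. word_length G S b)"
  have bound: "real (word_length G S h) \<le> W * (coord_norm h / m) + (W * card B + C)"
    if h: "h \<in> carrier G" for h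
  proof -
    define q where "q b = coord h b div m" for b
    define r where "r = h \<otimes> inv (lincomb G B q)"
    have lc: "lincomb G B q \<in> carrier G" by (simp add: lincomb_closed B_closed)
    have rc: "r \<in> carrier G" using h lc by (simp add: r_def)
    have "r [^] m = h [^] m \<otimes> inv (lincomb G B q [^] m)"
      using h lc by (simp add: r_def int_pow_distrib int_pow_inv)
    also have "\<dots> = lincomb G B (coord h) \<otimes> lincomb G B (\<lambda>b. - (m * q b))"
      by (simp only: pow_m_eq[OF h] lincomb_pow[OF B_closed] lincomb_minus[OF B_closed])
    also have "\<dots> = lincomb G B (\<lambda>b. coord h b + - (m * q b))"
      by (rule lincomb_add[OF B_closed, symmetric])
    also have "\<dots> = lincomb G B (\<lambda>b\<in>B. coord h b mod m)"
      by (intro lincomb_cong B_closed) (simp add: q_def minus_mult_div_eq_mod)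
    finally have "r [^] m = lincomb G B (\<lambda>b\<in>B. coord h b mod m)" .
    moreover have "(\<lambda>b\<in>B. coord h b mod m) \<in> B \<rightarrow>\<^sub>E {0..<m}" using m_pos by simp
    ultimately have "r \<in> R" unfolding R_def using rc by blast
    then have "word_length G S r \<le> C"
      unfolding C_def using finR by (intro member_le_sum) auto
    moreover have "h = r \<otimes> lincomb G B q"
      using h lc by (simp add: r_def m_assoc)
    ultimately have "word_length G S h \<le> C + word_length G S (lincomb G B q)"
      using word_length_mult[OF rc lc] by simp
    also have "\<dots> \<le> C + (\<Sum>b\<in>B. nat \<bar>q b\<bar> * word_length G S b)"
      using word_length_lincomb[OF finite_B B_closed] by simp
    also have "\<dots> \<le> C + (\<Sum>b\<in>B. nat \<bar>q b\<bar> * W)"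
      unfolding W_def using finite_B
      by (intro add_left_mono sum_mono mult_left_mono member_le_sum) auto
    finally have "real (word_length G S h) \<le> real (C + (\<Sum>b\<in>B. nat \<bar>q b\<bar> * W))"
      by (simp only: of_nat_le_iff)
    also have "\<dots> = C + (\<Sum>b\<in>B. real_of_int \<bar>q b\<bar>) * W"
      by (simp add: sum_distrib_right)
    finally have le: "real (word_length G S h) \<le> C + (\<Sum>b\<in>B. real_of_int \<bar>q b\<bar>) * W" .
    have "(\<Sum>b\<in>B. real_of_int \<bar>q b\<bar>) \<le> (\<Sum>b\<in>B. \<bar>coord h b\<bar> / m + 1)"
    proof (rule sum_mono)
      fix b
      have "\<bar>q b\<bar> \<le> \<bar>real_of_int (coord h b) / m\<bar> + 1"
        unfolding q_def floor_divide_of_int_eq[symmetric, where 'a = real] by linarith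
      then show "real_of_int \<bar>q b\<bar> \<le> \<bar>coord h b\<bar> / m + 1" using m_pos by simp
    qed
    moreover have "(\<Sum>b\<in>B. \<bar>coord h b\<bar> / m + 1) = coord_norm h / m + card B"
      by (simp add: coord_norm_def sum.distrib sum_divide_distrib)
    ultimately have "(\<Sum>b\<in>B. real_of_int \<bar>q b\<bar>) * W \<le> (coord_norm h / m + card B) * W"
      by (intro mult_right_mono) auto
    with le have "real (word_length G S h) \<le> C + (coord_norm h / m + card B) * W"
      by linarith
    then show ?thesis by (simp add: algebra_simps)
  qed
  show ?thesis
    by (rule exI[of _ "real W"], rule exI[of _ "real W * card B + C"]) (use bound in auto)
qed

text \<open>Both estimates compare with the sum norm of the coordinates, which is between the Euclidean norm
  and \<open>k\<close> times the Euclidean norm.\<close>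

lemma quasi_isometric_Euclidean:
  "quasi_isometric (carrier G) (\<lambda>x y. real (word_length G S (inv x \<otimes> y)))
     (topspace (Euclidean_space (card B))) (euclidean_metric (card B))"
proof -
  define k where "k = card B"
  obtain e where e: "bij_betw e {..<k} B"
    using ex_bij_betw_nat_finite[OF finite_B] by (auto simp: k_def atLeast0LessThan)
  have eB: "e i \<in> B" if "i < k" for i using e that by (auto simp: bij_betw_def)
  define f where "f h = (\<lambda>i. if i < k then coord h (e i) / m else 0)" for h
  define L where "L = (\<Sum>s\<in>S. coord_norm s)"
  obtain W C where W: "W \<ge> 0" and C: "C \<ge> 0"
    and WC: "\<And>h. h \<in> carrier G \<Longrightarrow> real (word_length G S h) \<le> W * (coord_norm h / m) + C"
    using word_length_le_coord_norm by blast
  have L: "L \<ge> 0" unfolding L_def coord_norm_def by (intro sum_nonneg) auto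
  \<comment> \<open>\<open>L\<close> is the Lipschitz constant, \<open>W * k\<close> the linear factor of the lower bound, and the
    summand \<open>1\<close> ensures \<open>A \<ge> 1\<close>.\<close>
  define A where "A = 1 + L + W * k"
  have A1: "A \<ge> 1" using L W by (simp add: A_def)
  have near: "word_length G S (inv x \<otimes> y) / A - (C + k) \<le> euclidean_metric k (f x) (f y)"
    "euclidean_metric k (f x) (f y) \<le> A * word_length G S (inv x \<otimes> y) + (C + k)"
    if xy: "x \<in> carrier G" "y \<in> carrier G" for x y
  proof -
    define h where "h = inv x \<otimes> y"
    have h: "h \<in> carrier G" using xy by (simp add: h_def)
    define N where "N = euclidean_metric k (f x) (f y)"
    define l where "l = real (word_length G S h)"
    have diff: "\<bar>f x i - f y i\<bar> = \<bar>coord h (e i)\<bar> / m" if "i < k" for i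
      using that xy eB m_pos
      by (simp add: f_def h_def coord_mult coord_inv flip: diff_divide_distrib)
    have sum: "(\<Sum>i<k. \<bar>f x i - f y i\<bar>) = coord_norm h / m"
    proof -
      have "(\<Sum>i<k. \<bar>f x i - f y i\<bar>) = (\<Sum>i<k. \<bar>coord h (e i)\<bar> / m)"
        by (intro sum.cong) (auto simp: diff)
      also have "\<dots> = (\<Sum>b\<in>B. \<bar>coord h b\<bar> / m)"
        by (rule sum.reindex_bij_betw[OF e])
      finally show ?thesis by (simp add: coord_norm_def sum_divide_distrib)
    qed
    have N0: "N \<ge> 0" by (simp add: N_def euclidean_metric_def)
    have norm_nn: "coord_norm h \<ge> 0" by (simp add: coord_norm_def sum_nonneg)
    have "N \<le> coord_norm h / m"
      unfolding N_def euclidean_metric_def sum[symmetric] by (rule L2_set_le_sum_abs)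
    also have "\<dots> \<le> coord_norm h / 1"
      using m_pos norm_nn by (intro divide_left_mono) auto
    also have "\<dots> \<le> L * l"
    proof -
      have "real_of_int (coord_norm h) \<le> real_of_int (L * int (word_length G S h))"
        unfolding of_int_le_iff L_def by (rule coord_norm_le_word_length[OF h])
      then show ?thesis by (simp add: l_def)
    qed
    also have "\<dots> \<le> A * l"
      using W by (intro mult_right_mono) (auto simp: A_def l_def)
    finally have upper: "N \<le> A * l" .
    have "coord_norm h / m \<le> (\<Sum>i<k. N)"
      unfolding sum[symmetric]
    proof (rule sum_mono)
      fix i assume "i \<in> {..<k}"
      then have "\<bar>f x i - f y i\<bar> \<le> L2_set (\<lambda>i. \<bar>f x i - f y i\<bar>) {..<k}"
        by (intro member_le_L2_set) auto
      then show "\<bar>f x i - f y i\<bar> \<le> N"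
        by (simp add: N_def euclidean_metric_def L2_set_def)
    qed
    then have "W * (coord_norm h / m) \<le> W * (k * N)"
      using W by (intro mult_left_mono) auto
    also have "\<dots> \<le> A * N"
      using N0 L by (simp add: A_def algebra_simps)
    finally have "l \<le> A * N + C" using WC[OF h] by (simp add: l_def)
    also have "\<dots> \<le> A * N + A * C" using A1 C mult_right_mono[of 1 A C] by simp
    finally have "l / A \<le> N + C"
      using A1 by (simp add: field_simps)
    then show "word_length G S (inv x \<otimes> y) / A - (C + k) \<le> euclidean_metric k (f x) (f y)"
      unfolding l_def N_def h_def by linarith
    show "euclidean_metric k (f x) (f y) \<le> A * word_length G S (inv x \<otimes> y) + (C + k)"
      using upper C unfolding l_def N_def h_def by linarith
  qed
  \<comment> \<open>Combinations of \<open>B\<close> reach all integer points, in particular the one obtained by rounding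
    \<open>z\<close> down.\<close>
  have dense: "\<exists>x\<in>carrier G. euclidean_metric k (f x) z \<le> C + k" for z
  proof -
    define x where "x = lincomb G B (\<lambda>b. \<lfloor>z (inv_into {..<k} e b)\<rfloor>)"
    have x: "x \<in> carrier G" by (simp add: x_def lincomb_closed B_closed)
    have "f x i = \<lfloor>z i\<rfloor>" if "i < k" for i
      using that eB m_pos bij_betw_inv_into_left[OF e, of i] by (simp add: f_def x_def coord_lincomb)
    then have "\<bar>f x i - z i\<bar> \<le> 1" if "i < k" for i
      using that by simp linarith
    then have "(\<Sum>i<k. \<bar>f x i - z i\<bar>) \<le> (\<Sum>i<k. 1)"
      by (intro sum_mono) auto
    then have "euclidean_metric k (f x) z \<le> k"
      unfolding euclidean_metric_def
      using L2_set_le_sum_abs[of "\<lambda>i. f x i - z i" "{..<k}"] by simp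
    then show ?thesis using x C by (intro bexI[of _ x]) auto
  qed
  have "f \<in> carrier G \<rightarrow> topspace (Euclidean_space k)"
    by (auto simp: f_def topspace_Euclidean_space)
  then show ?thesis
    unfolding quasi_isometric_def k_def[symmetric]
    using A1 C near dense by (intro exI[of _ f] exI[of _ A] exI[of _ "C + k"]) auto
qed

end

theorem (in fg_comm_group) torsion_free_quasi_isometric_Euclidean:
  assumes "\<And>x m. x \<in> carrier G \<Longrightarrow> m \<noteq> 0 \<Longrightarrow> x [^] (m::int) = \<one> \<Longrightarrow> x = \<one>"
  shows "quasi_isometric (carrier G) (\<lambda>x y. real (word_length G S (inv x \<otimes> y)))
    (topspace (Euclidean_space (abelian_rank G))) (euclidean_metric (abelian_rank G))"
proof -
  note S = finite_S S_closed generate_S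
  obtain B where B: "int_independent G B" "card B = abelian_rank G"
    "\<And>B'. int_independent G B' \<Longrightarrow> card B' \<le> card B"
    using obtain_max_int_independent[OF S] by metis
  obtain m :: int where m: "m > 0" "\<And>h. h \<in> carrier G \<Longrightarrow> h [^] m \<in> range (lincomb G B)"
    using obtain_common_denominator[OF S B(1,3)] by metis
  interpret rational_coordinates G S B m
    by unfold_locales (use B(1) m assms[of _ m] in auto)
  show ?thesis using quasi_isometric_Euclidean by (simp add: B(2))
qed

section \<open>Generalized Alexander quandles of abelian groups\<close>

definition translation :: "('a, 'm) monoid_scheme \<Rightarrow> 'a \<Rightarrow> 'a \<Rightarrow> 'a" where
  "translation G h = (\<lambda>x\<in>carrier G. x \<otimes>\<^bsub>G\<^esub> h)"

text \<open>The displacement group consists of the translations by \<open>H\<close>; \<open>K\<close> is \<open>H\<close> as a group.\<close>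

locale abelian_alexander = comm_group G for G (structure) +
  fixes \<sigma>
  assumes iso: "\<sigma> \<in> iso G G"
begin

abbreviation X where "X \<equiv> GAlex G \<sigma>"
abbreviation H where "H \<equiv> one_minus_inverse G \<sigma> ` carrier G"
abbreviation K where "K \<equiv> G\<lparr>carrier := H\<rparr>"

sublocale Q: quandle X by (rule quandle_GAlex[OF is_group iso])
sublocale A: group "Aut X" by (rule Q.group_Aut)

lemma carrier_X [simp]: "carrier X = carrier G"
  by (simp add: GAlex_def)

lemma bij: "bij_betw \<sigma> (carrier G) (carrier G)" and hom: "\<sigma> \<in> hom G G"
  using iso by (auto simp: iso_def)

sublocale \<sigma>: group_hom G G \<sigma> by unfold_locales (rule hom)

abbreviation \<sigma>' where "\<sigma>' \<equiv> inv_into (carrier G) \<sigma>"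

sublocale \<sigma>': group_hom G G \<sigma>'
  by unfold_locales (use iso_set_sym[OF iso] in \<open>simp add: iso_def\<close>)

lemma inverse [simp]: "x \<in> carrier G \<Longrightarrow> \<sigma> (\<sigma>' x) = x"
  using bij by (simp add: bij_betw_inv_into_right)

lemma one_minus_inverse_hom: "one_minus_inverse G \<sigma> \<in> hom G G"
  by (auto simp: hom_def one_minus_inverse_def inv_mult m_ac)

lemma subgroup_H: "subgroup H G"
proof -
  interpret group_hom G G "one_minus_inverse G \<sigma>"
    by unfold_locales (rule one_minus_inverse_hom)
  show ?thesis by (rule img_is_subgroup)
qed

lemma H_closed: "h \<in> H \<Longrightarrow> h \<in> carrier G"
  using subgroup.subset[OF subgroup_H] by blast

lemma comm_group_K: "comm_group K"
  by (rule group.group_comm_groupI[OF subgroup_imp_group[OF subgroup_H]])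
    (use H_closed m_comm in auto)

text \<open>The point symmetries are affine maps with the same linear part \<open>\<sigma>\<close>, so in the quotient the
  linear parts cancel. Instead of inverting \<open>s\<^sub>y\<close>, the proof checks that \<open>s\<^sub>y\<close> maps the translated
  point \<open>v \<otimes> h\<close> to \<open>s\<^sub>x v\<close>.\<close>

lemma point_symmetry_quotient:
  assumes "x \<in> carrier G" "y \<in> carrier G"
  shows "point_symmetry X x \<otimes>\<^bsub>Aut X\<^esub> inv\<^bsub>Aut X\<^esub> (point_symmetry X y)
    = translation G (one_minus_inverse G \<sigma> (inv x \<otimes> y))"
proof -
  let ?h = "one_minus_inverse G \<sigma> (inv x \<otimes> y)"
  have h: "?h \<in> carrier G" using assms by (simp add: one_minus_inverse_def)
  have s: "point_symmetry X x \<in> carrier (Aut X)" "point_symmetry X y \<in> carrier (Aut X)"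
    using assms Q.point_symmetry_Aut by auto
  have "(point_symmetry X x \<otimes>\<^bsub>Aut X\<^esub> inv\<^bsub>Aut X\<^esub> (point_symmetry X y)) v = v \<otimes> ?h"
    if v: "v \<in> carrier G" for v
  proof -
    have cancel: "a \<otimes> (q \<otimes> inv p \<otimes> inv (inv x \<otimes> y)) \<otimes> inv q \<otimes> y = a \<otimes> inv p \<otimes> x"
      if "a \<in> carrier G" "p \<in> carrier G" "q \<in> carrier G" for a p q
    proof -
      \<comment> \<open>Both sides have the same factors; pairing the inverse ones makes the rest simplify.\<close>
      have "a \<otimes> (q \<otimes> inv p \<otimes> inv (inv x \<otimes> y)) \<otimes> inv q \<otimes> y =
          (q \<otimes> inv q) \<otimes> ((inv y \<otimes> y) \<otimes> (a \<otimes> inv p \<otimes> x))"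
        using that assms by (simp only: inv_mult inv_inv m_ac m_closed inv_closed)
      then show ?thesis using that assms by simp
    qed
    have "\<sigma> ?h = \<sigma> y \<otimes> inv (\<sigma> x) \<otimes> inv (inv x \<otimes> y)"
      using assms by (simp add: one_minus_inverse_def m_comm)
    then have "point_symmetry X y (v \<otimes> ?h) = point_symmetry X x v"
      using assms v h cancel[of "\<sigma> v" "\<sigma> x" "\<sigma> y"]
      by (simp add: point_symmetry_def GAlex_def)
    then show ?thesis
      using Q.Aut_inv_apply(1)[OF s(2), of "v \<otimes> ?h"] v h by (simp add: Q.Aut_mult_apply)
  qed
  moreover have "point_symmetry X x \<otimes>\<^bsub>Aut X\<^esub> inv\<^bsub>Aut X\<^esub> (point_symmetry X y)
      \<in> extensional (carrier G)"
    using A.m_closed[OF s(1) A.inv_closed[OF s(2)]] by (simp add: Aut_simps(1) Bij_def)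
  ultimately show ?thesis
    by (intro extensionalityI[of _ "carrier G"]) (auto simp: translation_def)
qed

lemma Dis_generators:
  "{point_symmetry X x \<otimes>\<^bsub>Aut X\<^esub> inv\<^bsub>Aut X\<^esub> (point_symmetry X y) | x y.
      x \<in> carrier X \<and> y \<in> carrier X} = translation G ` H" (is "?L = ?R")
proof
  show "?L \<subseteq> ?R" by (auto simp: point_symmetry_quotient)
  show "?R \<subseteq> ?L"
  proof
    fix f assume "f \<in> ?R"
    then obtain v where v: "v \<in> carrier G" "f = translation G (one_minus_inverse G \<sigma> v)" by blast
    then have "f = point_symmetry X \<one> \<otimes>\<^bsub>Aut X\<^esub> inv\<^bsub>Aut X\<^esub> (point_symmetry X v)"
      by (simp add: point_symmetry_quotient)
    then show "f \<in> ?L" using v by auto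
  qed
qed

lemma translation_H_Aut: "h \<in> H \<Longrightarrow> translation G h \<in> carrier (Aut X)"
  using Q.Dis_gens_subset Dis_generators by blast

sublocale K: comm_group K by (rule comm_group_K)

sublocale T: group_hom K "Aut X" "translation G"
proof (unfold_locales, rule homI)
  fix g h assume gh: "g \<in> carrier K" "h \<in> carrier K"
  then have "g \<in> carrier G" "h \<in> carrier G" using H_closed by auto
  then show "translation G (g \<otimes>\<^bsub>K\<^esub> h) = translation G g \<otimes>\<^bsub>Aut X\<^esub> translation G h"
    by (auto simp: translation_def Aut_simps compose_def fun_eq_iff m_assoc)
qed (use translation_H_Aut in auto)

lemma inj_translation: "inj_on (translation G) H"
proof (rule inj_onI)
  fix g h assume "g \<in> H" "h \<in> H" "translation G g = translation G h"
  then have "\<one> \<otimes> g = \<one> \<otimes> h" by (metis one_closed restrict_apply' translation_def)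
  then show "g = h" using \<open>g \<in> H\<close> \<open>h \<in> H\<close> H_closed by simp
qed

text \<open>The generators form the image of a homomorphism, so generating adds nothing.\<close>

lemma Dis_eq: "Dis X = translation G ` H"
proof -
  have "generate (Aut X) (translation G ` H) = translation G ` generate K H"
    using T.generate_img[of H] by simp
  also have "generate K H = H"
    using K.generateI[OF K.subgroup_self, of H] by (auto intro: generate.incl dest: K.generate_in_carrier[rotated])
  finally show ?thesis unfolding Dis_def Dis_generators .
qed

lemma Dis_iso: "Dis_group X \<cong> K"
proof -
  have "translation G \<in> iso K (Dis_group X)"
    using T.homh inj_translation
    by (auto simp: iso_def Dis_group_def Dis_eq hom_def bij_betw_def)
  then show ?thesis
    using K.iso_sym by (auto simp: is_iso_def)
qed

text \<open>Orbits of the inner group are orbits of the displacement group, which acts by translations.\<close>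

lemma connected_component_eq:
  assumes "z \<in> carrier G"
  shows "(\<lambda>f. f z) ` Inn X = (\<lambda>h. z \<otimes> h) ` H"
proof
  show "(\<lambda>f. f z) ` Inn X \<subseteq> (\<lambda>h. z \<otimes> h) ` H"
  proof clarify
    fix f assume "f \<in> Inn X"
    then obtain g where "g \<in> Dis X" "g z = f z" using Q.Inn_step_Dis assms by force
    then show "f z \<in> (\<lambda>h. z \<otimes> h) ` H" using assms by (force simp: Dis_eq translation_def)
  qed
  have "Dis X \<subseteq> Inn X"
    unfolding Dis_def Inn_def
  proof (rule A.generate_subgroup_incl)
    show "subgroup (generate (Aut X) (point_symmetry X ` carrier X)) (Aut X)"
      by (rule A.generate_is_subgroup) (auto simp: Q.point_symmetry_Aut)
    then show "{point_symmetry X x \<otimes>\<^bsub>Aut X\<^esub> inv\<^bsub>Aut X\<^esub> (point_symmetry X y) | x y.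
        x \<in> carrier X \<and> y \<in> carrier X} \<subseteq> generate (Aut X) (point_symmetry X ` carrier X)"
      by (auto intro!: generate.eng subgroup.m_inv_closed intro: generate.incl)
  qed
  then have "translation G h \<in> Inn X" if "h \<in> H" for h using that Dis_eq by blast
  then have "z \<otimes> h \<in> (\<lambda>f. f z) ` Inn X" if "h \<in> H" for h
    using that assms by (intro image_eqI[of _ _ "translation G h"]) (auto simp: translation_def)
  then show "(\<lambda>h. z \<otimes> h) ` H \<subseteq> (\<lambda>f. f z) ` Inn X" by blast
qed

text \<open>The action of the displacement group is free, so the graph on a component is a Cayley graph of
  \<open>H\<close>.\<close>

lemma walk_iff_word:
  assumes S: "S \<subseteq> H" and x: "x \<in> carrier G"
  shows "(x, y) \<in> disp_edges X (translation G ` S) ^^ k \<longleftrightarrow> (\<exists>g. word K S k g \<and> y = x \<otimes> g)"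
proof (induction k arbitrary: y)
  case 0
  have "word K S 0 g \<longleftrightarrow> g = \<one>" for g
    by (auto elim: word.cases intro: word.empty[of K, simplified])
  then show ?case using x by auto
next
  case (Suc k)
  have word_H: "g \<in> carrier G" if "word K S k g" for k g
    using K.word_closed[OF that] S H_closed by auto
  have word_Suc: "word K S (Suc k) w \<longleftrightarrow>
      (\<exists>g. word K S k g \<and> (\<exists>s \<in> S \<union> (\<lambda>s. inv\<^bsub>K\<^esub> s) ` S. w = g \<otimes> s))" for w
    by (subst word.simps) (simp, blast)
  have steps: "translation G ` S \<union> (\<lambda>u. inv\<^bsub>Aut X\<^esub> u) ` translation G ` S
      = translation G ` (S \<union> (\<lambda>s. inv\<^bsub>K\<^esub> s) ` S)"
  proof -
    have "inv\<^bsub>Aut X\<^esub> (translation G s) = translation G (inv\<^bsub>K\<^esub> s)" if "s \<in> S" for s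
      using that S T.hom_inv[of s] by auto
    then show ?thesis by (auto simp: image_Un image_image)
  qed
  have edge: "(w, y) \<in> disp_edges X (translation G ` S) \<longleftrightarrow>
      (\<exists>s \<in> S \<union> (\<lambda>s. inv\<^bsub>K\<^esub> s) ` S. y = w \<otimes> s)" if "w \<in> carrier G" for w
  proof -
    have "(w, y) \<in> disp_edges X (translation G ` S) \<longleftrightarrow>
        (\<exists>u \<in> translation G ` (S \<union> (\<lambda>s. inv\<^bsub>K\<^esub> s) ` S). y = u w)"
      unfolding disp_edges_def steps using that by auto
    then show ?thesis using that by (simp add: translation_def)
  qed
  have "(x, y) \<in> disp_edges X (translation G ` S) ^^ Suc k \<longleftrightarrow>
      (\<exists>g. word K S k g \<and> (x \<otimes> g, y) \<in> disp_edges X (translation G ` S))"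
    using Suc.IH by auto
  also have "\<dots> \<longleftrightarrow> (\<exists>g. word K S k g \<and> (\<exists>s \<in> S \<union> (\<lambda>s. inv\<^bsub>K\<^esub> s) ` S. y = x \<otimes> (g \<otimes> s)))"
  proof (rule ex_cong1, rule conj_cong[OF refl])
    fix g assume "word K S k g"
    then have g: "g \<in> carrier G" by (rule word_H)
    have sc: "s \<in> carrier G" if "s \<in> S \<union> (\<lambda>s. inv\<^bsub>K\<^esub> s) ` S" for s
    proof -
      have "s \<in> carrier K" using that S K.inv_closed by auto
      then show ?thesis using H_closed by simp
    qed
    show "(x \<otimes> g, y) \<in> disp_edges X (translation G ` S) \<longleftrightarrow>
        (\<exists>s \<in> S \<union> (\<lambda>s. inv\<^bsub>K\<^esub> s) ` S. y = x \<otimes> (g \<otimes> s))"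
      unfolding edge[OF m_closed[OF x g]]
      by (rule bex_cong[OF refl]) (simp only: m_assoc[OF x g sc])
  qed
  also have "\<dots> \<longleftrightarrow> (\<exists>g. word K S (Suc k) g \<and> y = x \<otimes> g)"
    unfolding word_Suc by blast
  finally show ?case .
qed

lemma disp_metric_eq_word_length:
  assumes S: "S \<subseteq> H" and z: "z \<in> carrier G" and gh: "g \<in> H" "h \<in> H"
  shows "disp_metric X (translation G ` S) (z \<otimes> g) (z \<otimes> h) = word_length K S (inv\<^bsub>K\<^esub> g \<otimes>\<^bsub>K\<^esub> h)"
proof -
  have gc: "g \<in> carrier G" "h \<in> carrier G" using gh H_closed by auto
  have "(z \<otimes> g, z \<otimes> h) \<in> disp_edges X (translation G ` S) ^^ k \<longleftrightarrow> word K S k (inv g \<otimes> h)" for k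
  proof -
    have "z \<otimes> h = z \<otimes> g \<otimes> w \<longleftrightarrow> w = inv g \<otimes> h" if "word K S k w" for w
    proof -
      have "w \<in> carrier G" using K.word_closed[OF that] S H_closed by auto
      then have "z \<otimes> h = z \<otimes> g \<otimes> w \<longleftrightarrow> h = g \<otimes> w" using z gc by (simp add: m_assoc)
      then show ?thesis using gc \<open>w \<in> carrier G\<close> by (metis inv_solve_left)
    qed
    then show ?thesis using z gc S by (auto simp: walk_iff_word)
  qed
  then show ?thesis
    using gh by (simp add: disp_metric_def word_length_def m_inv_consistent[OF subgroup_H])
qed

text \<open>Translation is an injective homomorphism, so it reflects generation.\<close>

lemma generating_set_of_Dis:
  assumes U: "U \<subseteq> Dis X" "generate (Aut X) U = Dis X"
  obtains S where "S \<subseteq> H" "U = translation G ` S" "generate K S = H"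
proof -
  obtain S where S: "S \<subseteq> H" "U = translation G ` S"
    using U(1) unfolding Dis_eq by (auto simp: subset_image_iff)
  have "translation G ` generate K S = translation G ` H"
    using T.generate_img[of S] S U(2) by (simp add: Dis_eq)
  moreover have "generate K S \<subseteq> H" using K.generate_incl[of S] S by simp
  ultimately have "generate K S = H"
    using inj_translation by (simp add: inj_on_image_eq_iff)
  then show ?thesis using that S by blast
qed

end

text \<open>Translating by a base point identifies \<open>H\<close> with the component, isometrically for the word metric
  and the displacement metric.\<close>

theorem (in abelian_alexander) component_quasi_isometric_Euclidean:
  assumes tf: "\<And>x m. x \<in> carrier G \<Longrightarrow> m \<noteq> 0 \<Longrightarrow> x [^] (m::int) = \<one> \<Longrightarrow> x = \<one>"
    and C: "C \<in> connected_components X"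
    and U: "finite U" "U \<subseteq> Dis X" "generate (Aut X) U = Dis X"
  shows "quasi_isometric C (disp_metric X U)
    (topspace (Euclidean_space (abelian_rank K))) (euclidean_metric (abelian_rank K))"
proof -
  obtain S where S: "S \<subseteq> H" "U = translation G ` S" "generate K S = H"
    using generating_set_of_Dis U by metis
  have "finite S"
    using U(1) S inj_translation by (metis finite_imageD inj_on_subset)
  then interpret fg_comm_group K S
    by unfold_locales (use S in auto)
  obtain z where z: "z \<in> carrier G" "C = (\<lambda>h. z \<otimes> h) ` H"
    using C connected_component_eq by (auto simp: connected_components_def)
  show ?thesis
  proof (rule quasi_isometric_isometry)
    show "bij_betw (\<lambda>h. z \<otimes> h) (carrier K) C"
      using z H_closed by (auto simp: bij_betw_def inj_on_def)
    show "disp_metric X U (z \<otimes> g) (z \<otimes> h) = real (word_length K S (inv\<^bsub>K\<^esub> g \<otimes>\<^bsub>K\<^esub> h))"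
      if "g \<in> carrier K" "h \<in> carrier K" for g h
      using that disp_metric_eq_word_length[OF S(1) z(1)] S(2) by simp
    have "x = \<one>\<^bsub>K\<^esub>" if "x \<in> carrier K" "m \<noteq> 0" "x [^]\<^bsub>K\<^esub> (m::int) = \<one>\<^bsub>K\<^esub>" for x m
      using that tf[of x m] H_closed int_pow_consistent[OF subgroup_H, of x m] by simp
    then show "quasi_isometric (carrier K) (\<lambda>g h. real (word_length K S (inv\<^bsub>K\<^esub> g \<otimes>\<^bsub>K\<^esub> h)))
        (topspace (Euclidean_space (abelian_rank K))) (euclidean_metric (abelian_rank K))"
      by (rule torsion_free_quasi_isometric_Euclidean)
  qed
qed

section \<open>Free abelian groups of finite rank\<close>

lemma comm_group_Z_power: "comm_group (Z_power n)"
proof -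
  interpret group "Z_power n" by (simp add: Z_power_def)
  show ?thesis
    by (rule group_comm_groupI) (simp add: Z_power_def integer_group_def add.commute)
qed

text \<open>Each coordinate projection is a homomorphism to \<open>\<int>\<close>, so a torsion element vanishes in every
  coordinate.\<close>

lemma Z_power_torsion_free:
  assumes x: "x \<in> carrier (Z_power n)" and m: "m \<noteq> 0"
    and e: "x [^]\<^bsub>Z_power n\<^esub> (m::int) = \<one>\<^bsub>Z_power n\<^esub>"
  shows "x = \<one>\<^bsub>Z_power n\<^esub>"
proof -
  have "x i = 0" if i: "i < n" for i
  proof -
    have "(\<lambda>x. x i) \<in> hom (Z_power n) integer_group"
      using i by (auto simp: hom_def Z_power_def)
    moreover have "group (Z_power n)"
      using comm_group_Z_power comm_group.axioms(2) by blast
    ultimately have "\<one>\<^bsub>Z_power n\<^esub> i = x i [^]\<^bsub>integer_group\<^esub> m"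
      using hom_int_pow[of "\<lambda>x. x i" "Z_power n" integer_group x m] x
      unfolding e by simp
    then show ?thesis using m i by (simp add: Z_power_def)
  qed
  then have "x i = \<one>\<^bsub>Z_power n\<^esub> i" if "i \<in> {..<n}" for i
    using that by (simp add: Z_power_def)
  moreover have "x \<in> extensional {..<n}" "\<one>\<^bsub>Z_power n\<^esub> \<in> extensional {..<n}"
    using x by (auto simp: Z_power_def PiE_iff)
  ultimately show ?thesis by (intro extensionalityI)
qed

theorem proposition5p3:
  fixes n :: nat and t :: "(nat \<Rightarrow> int) \<Rightarrow> (nat \<Rightarrow> int)"
  assumes "t \<in> iso (Z_power n) (Z_power n)"
  shows "Dis_group (GAlex (Z_power n) t) \<cong>
           (Z_power n)\<lparr>carrier := one_minus_inverse (Z_power n) t ` carrier (Z_power n)\<rparr> \<and>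
         (\<forall>C \<in> connected_components (GAlex (Z_power n) t).
          \<forall>U. finite U \<and> U \<subseteq> Dis (GAlex (Z_power n) t) \<and>
              generate (Aut (GAlex (Z_power n) t)) U = Dis (GAlex (Z_power n) t) \<longrightarrow>
            (let k = hom_rank (Z_power n) (one_minus_inverse (Z_power n) t) in
             quasi_isometric C (disp_metric (GAlex (Z_power n) t) U)
               (topspace (Euclidean_space k)) (euclidean_metric k)))"
proof -
  interpret abelian_alexander "Z_power n" t
    using assms comm_group_Z_power
    by (simp add: abelian_alexander_def abelian_alexander_axioms_def)
  show ?thesis
    unfolding Let_def hom_rank_def
  proof (intro conjI ballI allI impI)
    fix C U
    assume "C \<in> connected_components X"
      "finite U \<and> U \<subseteq> Dis X \<and> generate (Aut X) U = Dis X"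
    then show "quasi_isometric C (disp_metric X U)
        (topspace (Euclidean_space (abelian_rank K))) (euclidean_metric (abelian_rank K))"
      by (intro component_quasi_isometric_Euclidean) (auto intro: Z_power_torsion_free)
  qed (rule Dis_iso)
qed

end
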